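(* Let $\alpha\in(0,1]$ and $\rho\in(0,1]$. Consider the following algorithm (Algorithm 1 with parameter $\rho$): maintain the set $\mathcal{J}$ of unfinished jobs (initially all jobs) and run Shortest Elapsed Time First on $\mathcal{J}$; whenever a job $j$ emits its signal at time $t$, run job $j$ alone for $(\frac{1}{\alpha\rho}-1)\cdot e_j(t)$ units of time; if $j$ completes during this period it is removed from $\mathcal{J}$, and in any case Shortest Elapsed Time First on $\mathcal{J}$ is then resumed. Then: (i) (consistency) if $\beta_j=\alpha$ for all $j$, then $\mathrm{ALG}\le(1+\alpha)\mathrm{OPT}$; (ii) (robustness) for all $(\beta_j)_j\in[0,1]^n$, $\mathrm{ALG}\le (1+\frac{1}{\rho\alpha})\mathrm{OPT}$; (iii) if $\rho\in(0,1)$, then for all $(\beta_j)_j\in[0,1]^n$, \[\mathrm{ALG}\le (1+\alpha)\mathrm{OPT}+\frac{2n}{\rho(1-\rho)\alpha^2}\sum_{i=1}^n|\beta_i-\alpha|\,p_i.\]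
   Context: Single-machine preemptive scheduling of $n$ jobs available at time $0$ with unknown processing times $p_j>0$; the machine's unit capacity can be split arbitrarily among unfinished jobs at each time. $e_j(t)$ is the processing job $j$ has received by time $t$; $C_j$ is the earliest $t$ with $e_j(t)\ge p_j$; $\mathrm{ALG}=\sum_jC_j$ and $\mathrm{OPT}$ is the optimal value. Each job $j$ emits a single signal at the moment its elapsed processing reaches $\beta_j p_j$, where $\beta_j\in[0,1]$ is unknown and $\alpha$ is the known announced value (the signal is meant to indicate that a fraction $\alpha$ of the job is done). The scheduler observes only signals and completions. Shortest Elapsed Time First (SETF) at each time shares the processing capacity equally among the unfinished jobs in $\mathcal J$ with the smallest elapsed time. *)

theory Defs
  imports "HOL-Analysis.Analysis"
begin

text \<open>
  Jobs are the numbers \<open>j < n\<close>, all available at time \<open>0\<close>. A schedule is given by its rates: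
  \<open>r j t\<close> is the share of the unit capacity that job \<open>j\<close> receives at time \<open>t \<ge> 0\<close>.
\<close>

definition elapsed :: "(nat \<Rightarrow> real \<Rightarrow> real) \<Rightarrow> nat \<Rightarrow> real \<Rightarrow> real" where
  "elapsed r j t = integral {0..t} (r j)"

definition schedule :: "nat \<Rightarrow> (nat \<Rightarrow> real) \<Rightarrow> (nat \<Rightarrow> real \<Rightarrow> real) \<Rightarrow> bool" where
  "schedule n p r \<longleftrightarrow>
     (\<forall>j<n. \<forall>t\<ge>0. r j integrable_on {0..t}) \<and>
     (\<forall>j<n. \<forall>t\<ge>0. 0 \<le> r j t) \<and>
     (\<forall>t\<ge>0. (\<Sum>j<n. r j t) \<le> 1) \<and>
     (\<forall>j<n. \<forall>t\<ge>0. p j \<le> elapsed r j t \<longrightarrow> r j t = 0)"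

text \<open>
  Since \<open>elapsed r j\<close> is continuous on \<open>{0..}\<close>, the infimum below is attained as soon as job \<open>j\<close>
  finishes at all; it is a junk value if \<open>j\<close> never finishes.
\<close>

definition completion_time :: "(nat \<Rightarrow> real) \<Rightarrow> (nat \<Rightarrow> real \<Rightarrow> real) \<Rightarrow> nat \<Rightarrow> real" where
  "completion_time p r j = Inf {t. 0 \<le> t \<and> p j \<le> elapsed r j t}"

definition total_completion_time :: "nat \<Rightarrow> (nat \<Rightarrow> real) \<Rightarrow> (nat \<Rightarrow> real \<Rightarrow> real) \<Rightarrow> real" where
  "total_completion_time n p r = (\<Sum>j<n. completion_time p r j)"

definition finishes_all :: "nat \<Rightarrow> (nat \<Rightarrow> real) \<Rightarrow> (nat \<Rightarrow> real \<Rightarrow> real) \<Rightarrow> bool" where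
  "finishes_all n p r \<longleftrightarrow> (\<forall>j<n. \<exists>t\<ge>0. p j \<le> elapsed r j t)"

definition opt :: "nat \<Rightarrow> (nat \<Rightarrow> real) \<Rightarrow> real" where
  "opt n p = Inf {total_completion_time n p r | r. schedule n p r \<and> finishes_all n p r}"

definition unfinished :: "nat \<Rightarrow> (nat \<Rightarrow> real) \<Rightarrow> (nat \<Rightarrow> real \<Rightarrow> real) \<Rightarrow> real \<Rightarrow> nat set" where
  "unfinished n p r t = {j. j < n \<and> elapsed r j t < p j}"

definition least_elapsed :: "nat \<Rightarrow> (nat \<Rightarrow> real) \<Rightarrow> (nat \<Rightarrow> real \<Rightarrow> real) \<Rightarrow> real \<Rightarrow> nat set" where
  "least_elapsed n p r t =
     {j \<in> unfinished n p r t. \<forall>i \<in> unfinished n p r t. elapsed r j t \<le> elapsed r i t}"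

definition setf_rate :: "nat \<Rightarrow> (nat \<Rightarrow> real) \<Rightarrow> (nat \<Rightarrow> real \<Rightarrow> real) \<Rightarrow> nat \<Rightarrow> real \<Rightarrow> real" where
  "setf_rate n p r j t =
     (if j \<in> least_elapsed n p r t then 1 / real (card (least_elapsed n p r t)) else 0)"

definition signal_time ::
  "(nat \<Rightarrow> real) \<Rightarrow> (nat \<Rightarrow> real) \<Rightarrow> (nat \<Rightarrow> real \<Rightarrow> real) \<Rightarrow> nat \<Rightarrow> real" where
  "signal_time p \<beta> r j = Inf {t. 0 \<le> t \<and> \<beta> j * p j \<le> elapsed r j t}"

text \<open>
  The times at which \<open>j\<close> runs alone, if its exclusive period starts at time \<open>a\<close>. The planned length
  depends on the elapsed time of \<open>j\<close> at its signal; the period ends early if \<open>j\<close> completes.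
\<close>

definition exclusive_period ::
  "real \<Rightarrow> real \<Rightarrow> (nat \<Rightarrow> real) \<Rightarrow> (nat \<Rightarrow> real) \<Rightarrow> (nat \<Rightarrow> real \<Rightarrow> real) \<Rightarrow> nat \<Rightarrow> real \<Rightarrow> real set"
  where
  "exclusive_period \<alpha> \<rho> p \<beta> r j a =
     {t. a \<le> t \<and>
         t < a + (1 / (\<alpha> * \<rho>) - 1) * elapsed r j (signal_time p \<beta> r j) \<and>
         elapsed r j t < p j}"

text \<open>
  \<open>r\<close> is a schedule produced by the algorithm. The exclusive period of job \<open>j\<close> starts at \<open>a j\<close>.
  If no other job signals at the same time, this is the signal time of \<open>j\<close>. Jobs that signal
  simultaneously get their exclusive periods one after the other, in an arbitrary order and without
  interruption: while a signal is waiting to be served, the exclusive period of another job is in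
  progress. Outside all exclusive periods the algorithm runs SETF.
\<close>

definition algorithm_run ::
  "real \<Rightarrow> real \<Rightarrow> nat \<Rightarrow> (nat \<Rightarrow> real) \<Rightarrow> (nat \<Rightarrow> real) \<Rightarrow> (nat \<Rightarrow> real \<Rightarrow> real) \<Rightarrow> bool" where
  "algorithm_run \<alpha> \<rho> n p \<beta> r \<longleftrightarrow>
     schedule n p r \<and>
     (\<exists>a :: nat \<Rightarrow> real.
        (\<forall>j<n. signal_time p \<beta> r j \<le> a j) \<and>
        (\<forall>j<n. \<forall>t. signal_time p \<beta> r j \<le> t \<and> t < a j \<longrightarrow>
           (\<exists>i<n. t \<in> exclusive_period \<alpha> \<rho> p \<beta> r i (a i))) \<and>
        (\<forall>i<n. \<forall>t \<in> exclusive_period \<alpha> \<rho> p \<beta> r i (a i).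
           \<forall>j<n. r j t = (if j = i then 1 else 0)) \<and>
        (\<forall>t\<ge>0. (\<forall>i<n. t \<notin> exclusive_period \<alpha> \<rho> p \<beta> r i (a i)) \<longrightarrow>
           (\<forall>j<n. r j t = setf_rate n p r j t)))"

end

theory Submission
  imports Defs
begin

text \<open>
  Both \<open>ALG\<close> and \<open>OPT\<close> split into contributions of pairs of jobs: as long as the machine is not idle,
  \<open>C\<^sub>j = (\<Sum>i. e\<^sub>i(C\<^sub>j))\<close>, so the pair \<open>i \<noteq> j\<close> contributes the mutual delay \<open>e\<^sub>i(C\<^sub>j) + e\<^sub>j(C\<^sub>i)\<close>, which
  is at least \<open>min p\<^sub>i p\<^sub>j\<close> in every schedule. For the algorithm, SETF never lets \<open>j\<close> overtake an
  unfinished job, and the exclusive period multiplies \<open>e\<^sub>j\<close> by at most \<open>1/(\<alpha>\<rho>)\<close>; so the delay is at most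
  \<open>(1 + 1/(\<alpha>\<rho>)) min p\<^sub>i p\<^sub>j\<close>. If \<open>\<beta>\<^sub>i, \<beta>\<^sub>j \<ge> \<alpha>\<rho>\<close>, both jobs complete in their exclusive periods, and if \<open>i\<close>
  is first, then \<open>j\<close> delays it by at most \<open>\<beta>\<^sub>i p\<^sub>i \<le> \<beta>\<^sub>j p\<^sub>j\<close>. If instead \<open>\<beta>\<^sub>j < \<alpha>\<rho>\<close>, then
  \<open>\<bar>\<beta>\<^sub>j - \<alpha>\<bar> p\<^sub>j\<close> exceeds \<open>\<alpha>(1 - \<rho>) p\<^sub>j\<close> and pays for the robustness bound.
\<close>

section \<open>First hitting times of continuous functions\<close>

text \<open>By continuity the set is closed, so it contains its infimum. The intermediate value
  theorem gives a point of value exactly \<open>c\<close> no later than \<open>h\<close>, and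
  minimality forces it to be \<open>h\<close>. Completion times and signal times are both of this
  kind.\<close>

lemma hitting_time:
  fixes f :: "real \<Rightarrow> real"
  assumes cont: "continuous_on {0..} f" and "f 0 \<le> c" and "0 \<le> T" "c \<le> f T"
  defines "h \<equiv> Inf {t. 0 \<le> t \<and> c \<le> f t}"
  shows "0 \<le> h" and "f h = c" and "\<And>t. 0 \<le> t \<Longrightarrow> c \<le> f t \<Longrightarrow> h \<le> t"
proof -
  let ?S = "{t. 0 \<le> t \<and> c \<le> f t}"
  have bdd: "bdd_below ?S" by (intro bdd_belowI[of _ 0]) auto
  have ne: "?S \<noteq> {}" using assms by auto
  have "closed {t \<in> {0..}. c \<le> f t}"
    by (intro continuous_on_closed_Collect_le cont continuous_intros)
  moreover have "{t \<in> {0..}. c \<le> f t} = ?S" by auto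
  ultimately have "closed ?S" by simp
  then have h: "h \<in> ?S" unfolding h_def by (intro closed_contains_Inf ne bdd)
  then show "0 \<le> h" by simp
  show le: "h \<le> t" if "0 \<le> t" "c \<le> f t" for t
    unfolding h_def using that by (intro cInf_lower bdd) auto
  have "continuous_on {0..h} f" by (rule continuous_on_subset[OF cont]) auto
  then obtain x where x: "0 \<le> x" "x \<le> h" "f x = c"
    using IVT'[of f 0 c h] h assms(2) by auto
  with le[of x] have "x = h" by simp
  with x show "f h = c" by simp
qed

section \<open>Elapsed times in a feasible schedule\<close>

locale feasible_schedule =
  fixes n :: nat and p :: "nat \<Rightarrow> real" and r :: "nat \<Rightarrow> real \<Rightarrow> real"
  assumes p_pos: "\<And>j. j < n \<Longrightarrow> 0 < p j"
    and sched: "schedule n p r"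
begin

abbreviation E :: "nat \<Rightarrow> real \<Rightarrow> real" where "E \<equiv> elapsed r"
abbreviation C :: "nat \<Rightarrow> real" where "C \<equiv> completion_time p r"

lemma rate_integrable: "j < n \<Longrightarrow> 0 \<le> t \<Longrightarrow> r j integrable_on {0..t}"
  and rate_nonneg: "j < n \<Longrightarrow> 0 \<le> t \<Longrightarrow> 0 \<le> r j t"
  and rate_sum: "0 \<le> t \<Longrightarrow> (\<Sum>j<n. r j t) \<le> 1"
  and rate_finished: "j < n \<Longrightarrow> 0 \<le> t \<Longrightarrow> p j \<le> E j t \<Longrightarrow> r j t = 0"
  using sched by (auto simp: schedule_def)

lemma rate_le_1:
  assumes "j < n" "0 \<le> t" shows "r j t \<le> 1"
proof -
  have "r j t \<le> (\<Sum>j<n. r j t)"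
    using assms by (intro member_le_sum) (auto intro: rate_nonneg)
  with rate_sum[OF assms(2)] show ?thesis by simp
qed

lemma rate_integrable_on:
  assumes "j < n" "0 \<le> s" shows "r j integrable_on {s..t}"
proof (cases "s \<le> t")
  case True
  then show ?thesis
    using assms rate_integrable[of j t] by (auto intro: integrable_on_subinterval)
qed auto

lemma elapsed_0 [simp]: "E j 0 = 0"
  by (simp add: elapsed_def)

lemma elapsed_diff:
  assumes "j < n" "0 \<le> s" "s \<le> t" shows "E j t = E j s + integral {s..t} (r j)"
  unfolding elapsed_def using assms
  by (intro Henstock_Kurzweil_Integration.integral_combine[symmetric] rate_integrable_on) auto

lemma elapsed_mono:
  assumes "j < n" "0 \<le> s" "s \<le> t" shows "E j s \<le> E j t"
proof -
  have "0 \<le> integral {s..t} (r j)"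
    using assms by (intro integral_nonneg rate_integrable_on) (auto intro: rate_nonneg)
  then show ?thesis using elapsed_diff[OF assms] by simp
qed

lemma elapsed_nonneg: "j < n \<Longrightarrow> 0 \<le> t \<Longrightarrow> 0 \<le> E j t"
  using elapsed_mono[of j 0 t] by simp

lemma elapsed_lipschitz:
  assumes "j < n" "0 \<le> s" "s \<le> t" shows "E j t \<le> E j s + (t - s)"
proof -
  have "integral {s..t} (r j) \<le> integral {s..t} (\<lambda>_. 1)"
    using assms by (intro integral_le rate_integrable_on) (auto intro: rate_le_1)
  then show ?thesis using elapsed_diff[OF assms] assms by simp
qed

lemma elapsed_const_rate:
  assumes "j < n" "0 \<le> s" "s \<le> t" and "\<And>x. s < x \<Longrightarrow> x < t \<Longrightarrow> r j x = c"
  shows "E j t = E j s + c * (t - s)"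
proof -
  have "integral {s..t} (r j) = integral {s..t} (\<lambda>_. c)"
    using assms by (intro integral_spike[of "{s, t}"]) auto
  then show ?thesis using elapsed_diff[OF assms(1-3)] assms by simp
qed

lemma elapsed_continuous:
  assumes "j < n" shows "continuous_on {0..} (E j)"
proof -
  have "1-lipschitz_on {0..} (E j)"
  proof (rule lipschitz_onI)
    fix x y :: real assume xy: "x \<in> {0..}" "y \<in> {0..}"
    show "dist (E j x) (E j y) \<le> 1 * dist x y"
      using xy elapsed_lipschitz[OF assms, of x y] elapsed_lipschitz[OF assms, of y x]
        elapsed_mono[OF assms, of x y] elapsed_mono[OF assms, of y x]
      by (cases "x \<le> y") (auto simp: dist_real_def)
  qed simp
  then show ?thesis by (rule lipschitz_on_continuous_on)
qed

text \<open>A barrier argument: after the last time in \<open>{0..t}\<close> at which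
  \<open>E j\<close> is at most \<open>G\<close>, the rate of \<open>j\<close> vanishes, so
  \<open>E j\<close> stays constant while \<open>G\<close> does not decrease. No derivative of
  \<open>E j\<close> is involved, since rates are merely integrable.\<close>

lemma elapsed_le_if_rate_zero:
  assumes j: "j < n" and t: "0 \<le> t" and G: "continuous_on {0..} G"
    and G_mono: "\<And>x y. 0 \<le> x \<Longrightarrow> x \<le> y \<Longrightarrow> G x \<le> G y" and G0: "0 \<le> G 0"
    and zero: "\<And>x. 0 \<le> x \<Longrightarrow> x < t \<Longrightarrow> G x < E j x \<Longrightarrow> r j x = 0"
  shows "E j t \<le> G t"
proof -
  let ?S = "{x \<in> {0..t}. E j x \<le> G x}"
  have sub: "{0..t} \<subseteq> {0..}" by auto
  have "closed ?S"
    by (intro continuous_on_closed_Collect_le continuous_on_subset[OF G sub]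
        continuous_on_subset[OF elapsed_continuous[OF j] sub]) auto
  moreover have "?S \<noteq> {}" "bdd_above ?S"
    using t G0 by (auto intro!: exI[of _ 0] bdd_aboveI[of _ t])
  ultimately have u: "Sup ?S \<in> ?S" by (intro closed_contains_Sup)
  have "r j x = 0" if "Sup ?S < x" "x < t" for x
  proof (rule zero)
    show "0 \<le> x" using u that by simp
    show "G x < E j x"
    proof (rule ccontr)
      assume "\<not> G x < E j x"
      then have "x \<in> ?S" using u that by auto
      then have "x \<le> Sup ?S" by (intro cSup_upper \<open>bdd_above ?S\<close>)
      with that show False by simp
    qed
  qed fact
  then have "E j t = E j (Sup ?S)"
    using elapsed_const_rate[OF j, of "Sup ?S" t 0] u by auto
  also have "\<dots> \<le> G (Sup ?S)" using u by simp
  also have "\<dots> \<le> G t" using u by (intro G_mono) auto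
  finally show ?thesis .
qed

lemma elapsed_le_size:
  assumes "j < n" "0 \<le> t" shows "E j t \<le> p j"
  using assms p_pos[of j]
  by (intro elapsed_le_if_rate_zero[where G = "\<lambda>_. p j"] rate_finished) auto

lemma elapsed_sum:
  assumes "0 \<le> t" shows "(\<Sum>j<n. E j t) = integral {0..t} (\<lambda>x. \<Sum>j<n. r j x)"
  unfolding elapsed_def using assms
  by (intro integral_sum[symmetric] rate_integrable) auto

lemma elapsed_sum_le:
  assumes "0 \<le> t" shows "(\<Sum>j<n. E j t) \<le> t"
proof -
  have "integral {0..t} (\<lambda>x. \<Sum>j<n. r j x) \<le> integral {0..t} (\<lambda>_. 1)"
    using assms by (intro integral_le integrable_sum rate_integrable) (auto intro: rate_sum)
  then show ?thesis using assms by (simp add: elapsed_sum)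
qed

lemma elapsed_sum_busy:
  assumes "0 \<le> t" and "\<And>x. 0 \<le> x \<Longrightarrow> x < t \<Longrightarrow> (\<Sum>j<n. r j x) = 1"
  shows "(\<Sum>j<n. E j t) = t"
proof -
  have "integral {0..t} (\<lambda>x. \<Sum>j<n. r j x) = integral {0..t} (\<lambda>_. 1)"
    using assms by (intro integral_spike[of "{t}"]) auto
  then show ?thesis using assms by (simp add: elapsed_sum)
qed

end

section \<open>Completion times, mutual delays and the lower bound on the optimum\<close>

locale finishing_schedule = feasible_schedule +
  assumes fin: "finishes_all n p r"
begin

lemma
  assumes j: "j < n"
  shows completion_nonneg: "0 \<le> C j"
    and elapsed_completion: "E j (C j) = p j"
    and completion_le: "\<And>t. 0 \<le> t \<Longrightarrow> p j \<le> E j t \<Longrightarrow> C j \<le> t"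
proof -
  obtain T where T: "0 \<le> T" "p j \<le> E j T" using fin j by (auto simp: finishes_all_def)
  have 0: "E j 0 \<le> p j" using p_pos[OF j] by simp
  note h = hitting_time[OF elapsed_continuous[OF j] 0 T, folded completion_time_def]
  show "0 \<le> C j" "E j (C j) = p j" "\<And>t. 0 \<le> t \<Longrightarrow> p j \<le> E j t \<Longrightarrow> C j \<le> t"
    using h by auto
qed

lemma elapsed_after_completion:
  assumes "j < n" "C j \<le> t" shows "E j t = p j"
proof (rule antisym)
  have "0 \<le> t" using completion_nonneg[OF assms(1)] assms(2) by simp
  then show "E j t \<le> p j" by (rule elapsed_le_size[OF assms(1)])
  show "p j \<le> E j t"
    using elapsed_mono[OF assms(1) completion_nonneg[OF assms(1)] assms(2)]
      elapsed_completion[OF assms(1)] by simp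
qed

lemma elapsed_lt_before_completion:
  assumes "j < n" "0 \<le> t" "t < C j" shows "E j t < p j"
  using completion_le[OF assms(1,2)] assms(3) by fastforce

definition delay :: "nat \<Rightarrow> nat \<Rightarrow> real" where
  "delay i j = E i (C j) + E j (C i)"

lemma delay_commute: "delay i j = delay j i"
  by (simp add: delay_def)

lemma sum_delay: "(\<Sum>j<n. \<Sum>i<n. delay i j) = 2 * (\<Sum>j<n. \<Sum>i<n. E i (C j))"
proof -
  have "(\<Sum>j<n. \<Sum>i<n. E j (C i)) = (\<Sum>j<n. \<Sum>i<n. E i (C j))" by (rule sum.swap)
  then show ?thesis by (simp add: delay_def sum.distrib)
qed

text \<open>Ordering a pair by completion leaves the progress of the later job at \<open>C i\<close>
  as the only unknown; all bounds on \<open>delay\<close> start from here.\<close>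

lemma delay_eq:
  assumes "i < n" "j < n" "C i \<le> C j" shows "delay i j = p i + E j (C i)"
  using elapsed_after_completion[OF assms(1,3)] by (simp add: delay_def)

end

text \<open>The diagonal is doubled because every pair \<open>i \<noteq> j\<close> occurs twice in the double sums.\<close>

definition pair_weight :: "(nat \<Rightarrow> real) \<Rightarrow> nat \<Rightarrow> nat \<Rightarrow> real" where
  "pair_weight p i j = (if i = j then 2 * p j else min (p i) (p j))"

lemma pair_weight_commute: "pair_weight p i j = pair_weight p j i"
  by (simp add: pair_weight_def min.commute)

text \<open>When the second job of a pair finishes, the first has already received its full size,
  which is at least the minimum. Unit capacity bounds the sum of all elapsed times at
  \<open>C j\<close> by \<open>C j\<close>.\<close>

lemma (in finishing_schedule) total_completion_time_ge:
  "(\<Sum>j<n. \<Sum>i<n. pair_weight p i j) \<le> 2 * total_completion_time n p r"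
proof -
  have le: "pair_weight p i j \<le> delay i j" if ij: "i < n" "j < n" "C i \<le> C j" for i j
  proof -
    have "i \<noteq> j \<Longrightarrow> 0 \<le> E j (C i)" using ij by (intro elapsed_nonneg completion_nonneg)
    then show ?thesis using delay_eq[OF ij] elapsed_completion[OF ij(1)]
      by (auto simp: pair_weight_def)
  qed
  have "pair_weight p i j \<le> delay i j" if "i < n" "j < n" for i j
    using le[of i j] le[of j i] that
    by (cases "C i \<le> C j") (auto simp: pair_weight_commute[of p i j] delay_commute[of i j])
  then have "(\<Sum>j<n. \<Sum>i<n. pair_weight p i j) \<le> (\<Sum>j<n. \<Sum>i<n. delay i j)"
    by (intro sum_mono) auto
  also have "\<dots> \<le> 2 * (\<Sum>j<n. C j)"
    unfolding sum_delay by (intro mult_left_mono sum_mono elapsed_sum_le completion_nonneg) auto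
  finally show ?thesis by (simp add: total_completion_time_def)
qed

lemma (in finishing_schedule) opt_ge:
  "(\<Sum>j<n. \<Sum>i<n. pair_weight p i j) \<le> 2 * opt n p"
proof -
  have "(\<Sum>j<n. \<Sum>i<n. pair_weight p i j) / 2 \<le> opt n p"
    unfolding opt_def
  proof (rule cInf_greatest)
    \<comment> \<open>The schedule \<open>r\<close> itself is a candidate, so the infimum is not a
      default value.\<close>
    show "{total_completion_time n p r |r. schedule n p r \<and> finishes_all n p r} \<noteq> {}"
      using sched fin by auto
    fix x assume "x \<in> {total_completion_time n p r |r. schedule n p r \<and> finishes_all n p r}"
    then obtain r' where r': "x = total_completion_time n p r'" "schedule n p r'" "finishes_all n p r'"
      by auto
    interpret other: finishing_schedule n p r'
      by unfold_locales (use r' p_pos in auto)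
    show "(\<Sum>j<n. \<Sum>i<n. pair_weight p i j) / 2 \<le> x"
      using other.total_completion_time_ge r' by simp
  qed
  then show ?thesis by simp
qed

section \<open>Runs of the algorithm: no idling, signals and starts of exclusive periods\<close>

text \<open>The existentially quantified start times of \<open>algorithm_run\<close> are fixed here
  as \<open>a\<close>, so that all lemmas share one choice of them.\<close>

locale signal_run = feasible_schedule +
  fixes \<alpha> \<rho> :: real and \<beta> :: "nat \<Rightarrow> real" and a :: "nat \<Rightarrow> real"
  assumes \<alpha>: "0 < \<alpha>" "\<alpha> \<le> 1" and \<rho>: "0 < \<rho>" "\<rho> \<le> 1"
    and \<beta>: "\<And>j. j < n \<Longrightarrow> 0 \<le> \<beta> j" "\<And>j. j < n \<Longrightarrow> \<beta> j \<le> 1"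
    and signal_le_start: "\<And>j. j < n \<Longrightarrow> signal_time p \<beta> r j \<le> a j"
    and waiting: "\<And>j t. j < n \<Longrightarrow> signal_time p \<beta> r j \<le> t \<Longrightarrow> t < a j \<Longrightarrow>
      \<exists>i<n. t \<in> exclusive_period \<alpha> \<rho> p \<beta> r i (a i)"
    and exclusive: "\<And>i j t. i < n \<Longrightarrow> j < n \<Longrightarrow> t \<in> exclusive_period \<alpha> \<rho> p \<beta> r i (a i) \<Longrightarrow>
      r j t = (if j = i then 1 else 0)"
    and setf: "\<And>j t. j < n \<Longrightarrow> 0 \<le> t \<Longrightarrow> (\<And>i. i < n \<Longrightarrow> t \<notin> exclusive_period \<alpha> \<rho> p \<beta> r i (a i)) \<Longrightarrow>
      r j t = setf_rate n p r j t"
begin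

abbreviation X :: "nat \<Rightarrow> real set" where "X i \<equiv> exclusive_period \<alpha> \<rho> p \<beta> r i (a i)"
abbreviation s :: "nat \<Rightarrow> real" where "s \<equiv> signal_time p \<beta> r"

lemma busy:
  assumes "0 \<le> t" "j < n" "E j t < p j" shows "(\<Sum>i<n. r i t) = 1"
proof (cases "\<exists>k<n. t \<in> X k")
  case True
  then obtain k where k: "k < n" "t \<in> X k" by auto
  then have "(\<Sum>i<n. r i t) = (\<Sum>i<n. if i = k then 1 else 0)"
    by (intro sum.cong exclusive) auto
  with k show ?thesis by simp
next
  case False
  let ?U = "unfinished n p r t" and ?L = "least_elapsed n p r t"
  have U: "finite ?U" "?U \<noteq> {}" using assms by (auto simp: unfinished_def)
  have L: "?L \<subseteq> {..<n}" by (auto simp: least_elapsed_def unfinished_def)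
  \<comment> \<open>A minimal unfinished job exists, so the SETF shares do not divide by
    zero.\<close>
  have "arg_min_on (\<lambda>i. E i t) ?U \<in> ?L"
    using arg_min_if_finite[OF U, of "\<lambda>i. E i t"] by (auto simp: least_elapsed_def not_less)
  moreover have "finite ?L" by (rule finite_subset[OF L]) simp
  ultimately have card: "card ?L \<noteq> 0" by auto
  have "(\<Sum>i<n. r i t) = (\<Sum>i<n. setf_rate n p r i t)"
    using False assms by (intro sum.cong setf) auto
  also have "\<dots> = (\<Sum>i\<in>?L. 1 / real (card ?L))"
    unfolding setf_rate_def using L by (subst sum.inter_restrict[symmetric]) (auto simp: Int_absorb1)
  finally show ?thesis using card by simp
qed

text \<open>A job that never finishes would keep the machine busy forever, and by time
  \<open>T\<close> more work would be done than all jobs contain.\<close>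

lemma finishes: "finishes_all n p r"
  unfolding finishes_all_def
proof (intro allI impI, rule ccontr)
  fix j assume j: "j < n" and *: "\<not> (\<exists>t\<ge>0. p j \<le> E j t)"
  define T where "T = (\<Sum>i<n. p i) + 1"
  have "0 \<le> (\<Sum>i<n. p i)" by (intro sum_nonneg less_imp_le p_pos) simp
  then have T: "0 \<le> T" by (simp add: T_def)
  have "(\<Sum>i<n. E i T) = T"
    using T * j by (intro elapsed_sum_busy busy[of _ j]) (auto simp: not_le[symmetric])
  moreover have "(\<Sum>i<n. E i T) \<le> (\<Sum>i<n. p i)"
    using T by (intro sum_mono elapsed_le_size) auto
  ultimately show False by (simp add: T_def)
qed

sublocale finishing_schedule
  by unfold_locales (rule finishes)

lemma total_completion_time_eq: "2 * total_completion_time n p r = (\<Sum>j<n. \<Sum>i<n. delay i j)"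
proof -
  have "(\<Sum>i<n. E i (C j)) = C j" if "j < n" for j
    using that by (intro elapsed_sum_busy busy[of _ j] elapsed_lt_before_completion completion_nonneg) auto
  then show ?thesis by (simp add: sum_delay total_completion_time_def)
qed

lemma
  assumes j: "j < n"
  shows signal_nonneg: "0 \<le> s j"
    and elapsed_signal: "E j (s j) = \<beta> j * p j"
    and signal_le_completion: "s j \<le> C j"
proof -
  have "E j 0 \<le> \<beta> j * p j" using \<beta>[OF j] p_pos[OF j] by simp
  moreover have le: "\<beta> j * p j \<le> E j (C j)"
    using \<beta>[OF j] p_pos[OF j] elapsed_completion[OF j] by simp
  ultimately have h: "0 \<le> s j" "E j (s j) = \<beta> j * p j"
    "\<And>t. 0 \<le> t \<Longrightarrow> \<beta> j * p j \<le> E j t \<Longrightarrow> s j \<le> t"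
    using hitting_time[OF elapsed_continuous[OF j] _ completion_nonneg[OF j], of "\<beta> j * p j",
        folded signal_time_def]
    by auto
  show "0 \<le> s j" "E j (s j) = \<beta> j * p j" by fact+
  show "s j \<le> C j" by (intro h(3) completion_nonneg[OF j] le)
qed

lemma start_nonneg: "j < n \<Longrightarrow> 0 \<le> a j"
  using signal_nonneg signal_le_start order_trans by blast

text \<open>While \<open>j\<close> waits for its period, another job runs alone, so \<open>j\<close>
  stays at its signal level.\<close>

lemma elapsed_start:
  assumes j: "j < n" shows "E j (a j) = \<beta> j * p j"
proof -
  have "r j t = 0" if t: "s j < t" "t < a j" for t
  proof -
    obtain i where i: "i < n" "t \<in> X i" using waiting[OF j, of t] t by auto
    moreover have "i \<noteq> j" using t i by (auto simp: exclusive_period_def)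
    ultimately show ?thesis using exclusive[OF i(1) j i(2)] by simp
  qed
  then show ?thesis
    using elapsed_const_rate[OF j signal_nonneg[OF j] signal_le_start[OF j], of 0]
      elapsed_signal[OF j] by simp
qed

section \<open>Overtaking and the robust bound on delays\<close>

text \<open>The unfinished job \<open>i\<close> keeps every job ahead of it out of the SETF set;
  such a job can run only in its own exclusive period.\<close>

lemma rate_zero_if_ahead:
  assumes "i < n" "j < n" "0 \<le> t" "t \<notin> X j" "t < C i" "E i t < E j t"
  shows "r j t = 0"
proof (cases "\<exists>k<n. t \<in> X k")
  case True
  then obtain k where "k < n" "t \<in> X k" by auto
  with assms show ?thesis using exclusive[of k j t] by auto
next
  case False
  have "i \<in> unfinished n p r t"
    using assms elapsed_lt_before_completion by (simp add: unfinished_def)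
  then have "j \<notin> least_elapsed n p r t" using assms by (auto simp: least_elapsed_def not_le)
  then show ?thesis using False assms setf[of j t] by (auto simp: setf_rate_def)
qed

lemma elapsed_le_before_start:
  assumes ij: "i < n" "j < n" and t: "0 \<le> t" "t \<le> C i" "t \<le> a j"
  shows "E j t \<le> E i t"
proof (rule elapsed_le_if_rate_zero[where G = "E i"])
  fix x assume "0 \<le> x" "x < t" "E i x < E j x"
  then show "r j x = 0"
    using ij t by (intro rate_zero_if_ahead[of i j]) (auto simp: exclusive_period_def)
qed (use ij t in \<open>auto intro: elapsed_continuous elapsed_mono\<close>)

text \<open>The barrier is now \<open>E i\<close> scaled up. Only the exclusive period of
  \<open>j\<close> can carry \<open>j\<close> ahead of \<open>i\<close>; at its start
  \<open>j\<close> was not ahead, and its planned length multiplies the elapsed time of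
  \<open>j\<close> by at most \<open>1 / (\<alpha> * \<rho>)\<close>.\<close>

lemma elapsed_le_scaled:
  assumes ij: "i < n" "j < n" and t: "0 \<le> t" "t \<le> C i"
  shows "E j t \<le> E i t / (\<alpha> * \<rho>)"
proof (rule elapsed_le_if_rate_zero[where G = "\<lambda>t. E i t / (\<alpha> * \<rho>)"])
  have ar: "0 < \<alpha> * \<rho>" "\<alpha> * \<rho> \<le> 1" using \<alpha> \<rho> by (auto intro: mult_le_one)
  show "continuous_on {0..} (\<lambda>t. E i t / (\<alpha> * \<rho>))"
    using ar ij by (intro continuous_intros elapsed_continuous) auto
  show "E i x / (\<alpha> * \<rho>) \<le> E i y / (\<alpha> * \<rho>)" if "0 \<le> x" "x \<le> y" for x y
    using that ar ij by (intro divide_right_mono elapsed_mono) auto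
  fix x assume x: "0 \<le> x" "x < t" and gt: "E i x / (\<alpha> * \<rho>) < E j x"
  show "r j x = 0"
  proof (rule rate_zero_if_ahead[OF ij])
    have "E i x * (\<alpha> * \<rho>) \<le> E i x * 1"
      using ar x ij by (intro mult_left_mono elapsed_nonneg) auto
    then have "E i x \<le> E i x / (\<alpha> * \<rho>)" using ar by (simp add: field_simps)
    with gt show "E i x < E j x" by simp
    show "x \<notin> X j"
    proof
      assume "x \<in> X j"
      then have X: "a j \<le> x" "x < a j + (1 / (\<alpha> * \<rho>) - 1) * E j (a j)"
        by (auto simp: exclusive_period_def elapsed_signal elapsed_start ij)
      \<comment> \<open>Progress within the period is at most the time spent in it, which is below
        the planned length.\<close>
      have "E j x \<le> E j (a j) + (x - a j)"
        using X ij by (intro elapsed_lipschitz start_nonneg) auto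
      also have "\<dots> \<le> E j (a j) / (\<alpha> * \<rho>)" using X by (simp add: algebra_simps)
      also have "E j (a j) \<le> E i (a j)"
        using X x t ij by (intro elapsed_le_before_start start_nonneg) auto
      also have "E i (a j) \<le> E i x" using X ij by (intro elapsed_mono start_nonneg) auto
      finally have "E j x \<le> E i x / (\<alpha> * \<rho>)" using ar by (simp add: divide_right_mono)
      with gt show False by simp
    qed
  qed (use x t in auto)
qed (use ij t in auto)

text \<open>The scaled comparison is used in both directions at time \<open>C i\<close>. If
  \<open>p i\<close> is the minimum, it bounds \<open>E j (C i)\<close>; if \<open>p j\<close> is,
  it bounds \<open>p i\<close> by \<open>p j / (\<alpha> * \<rho>)\<close>, while
  \<open>E j (C i) \<le> p j\<close>.\<close>

lemma delay_le_robust_aux: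
  assumes ij: "i < n" "j < n" and le: "C i \<le> C j"
  shows "delay i j \<le> min (p i) (p j) + min (p i) (p j) / (\<alpha> * \<rho>)"
proof -
  have ar: "0 < \<alpha> * \<rho>" using \<alpha> \<rho> by auto
  have "E j (C i) \<le> p i / (\<alpha> * \<rho>)"
    using elapsed_le_scaled[OF ij completion_nonneg[OF ij(1)]] elapsed_completion[OF ij(1)] by simp
  moreover have "E j (C i) \<le> p j" using ij by (intro elapsed_le_size completion_nonneg)
  moreover have "p i \<le> E j (C i) / (\<alpha> * \<rho>)"
    using elapsed_le_scaled[OF ij(2,1) completion_nonneg[OF ij(1)] le] elapsed_completion[OF ij(1)]
    by simp
  moreover have "E j (C i) / (\<alpha> * \<rho>) \<le> p j / (\<alpha> * \<rho>)"
    using \<open>E j (C i) \<le> p j\<close> ar by (simp add: divide_right_mono)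
  ultimately show ?thesis using delay_eq[OF ij le] by (auto simp: min_def)
qed

lemma delay_le_robust:
  assumes "i < n" "j < n"
  shows "delay i j \<le> min (p i) (p j) + min (p i) (p j) / (\<alpha> * \<rho>)"
proof (cases "C i \<le> C j")
  case True
  with assms show ?thesis by (rule delay_le_robust_aux)
next
  case False
  then show ?thesis
    using delay_le_robust_aux[OF assms(2,1)]
    by (simp add: delay_commute[of i j] min.commute[of "p i"])
qed

section \<open>Jobs whose signal is not too early\<close>

text \<open>The full planned period would raise the elapsed time from \<open>\<beta> j * p j\<close>
  to \<open>\<beta> j * p j / (\<alpha> * \<rho>)\<close>, which is at least \<open>p j\<close>.
  Hence completion, not the planned end \<open>T\<close>, terminates the period.\<close>

lemma exclusive_until_completion:
  assumes j: "j < n" and good: "\<alpha> * \<rho> \<le> \<beta> j" and t: "a j \<le> t" "t < C j"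
  shows "t \<in> X j"
proof -
  have ar: "0 < \<alpha> * \<rho>" "\<alpha> * \<rho> \<le> 1" using \<alpha> \<rho> by (auto intro: mult_le_one)
  define T where "T = a j + (1 / (\<alpha> * \<rho>) - 1) * (\<beta> j * p j)"
  have "a j \<le> T" unfolding T_def using ar \<beta>[OF j] p_pos[OF j] by simp
  have mem: "x \<in> X j" if "a j \<le> x" "x < T" "x < C j" for x
    using that start_nonneg[OF j] elapsed_lt_before_completion[OF j, of x]
    by (simp add: exclusive_period_def elapsed_signal[OF j] T_def)
  have "t < T"
  proof (rule ccontr)
    assume "\<not> t < T"
    then have "E j T = E j (a j) + 1 * (T - a j)"
      using \<open>a j \<le> T\<close> t start_nonneg[OF j] exclusive[OF j j mem]
      by (intro elapsed_const_rate j) auto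
    also have "\<dots> = \<beta> j / (\<alpha> * \<rho>) * p j"
      by (simp add: elapsed_start[OF j] T_def algebra_simps)
    also have "\<dots> \<ge> 1 * p j"
      using good ar p_pos[OF j] by (intro mult_right_mono) auto
    finally have "C j \<le> T"
      using \<open>a j \<le> T\<close> start_nonneg[OF j] by (intro completion_le j) auto
    with \<open>\<not> t < T\<close> t show False by simp
  qed
  then show ?thesis using mem t by auto
qed

text \<open>Between the signal and the completion of \<open>i\<close>, the job \<open>j\<close>
  receives nothing, and at the signal of \<open>i\<close> both jobs have equal elapsed time because
  neither period has begun earlier.\<close>

lemma
  assumes ij: "i < n" "j < n" "i \<noteq> j" and le: "C i \<le> C j"
    and good: "\<alpha> * \<rho> \<le> \<beta> i" "\<alpha> * \<rho> \<le> \<beta> j"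
  shows elapsed_other_le_signal: "E j (C i) \<le> \<beta> i * p i"
    and signal_levels_ordered: "\<beta> i * p i \<le> \<beta> j * p j"
proof -
  \<comment> \<open>Otherwise \<open>j\<close> would run alone from \<open>a j\<close> up to
    \<open>C i\<close>, so \<open>i\<close> would already have been complete at
    \<open>a j\<close>.\<close>
  have start: "C i \<le> a j"
  proof (rule ccontr)
    assume "\<not> C i \<le> a j"
    then have "E i (C i) = E i (a j) + 0 * (C i - a j)"
      using exclusive[OF ij(2,1) exclusive_until_completion[OF ij(2) good(2)]] le ij
      by (intro elapsed_const_rate ij start_nonneg) auto
    then have "C i \<le> a j" using ij by (intro completion_le start_nonneg) (auto simp: elapsed_completion)
    with \<open>\<not> C i \<le> a j\<close> show False by simp
  qed
  have s: "0 \<le> s i" "s i \<le> C i" using signal_nonneg signal_le_completion ij by auto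
  \<comment> \<open>Until \<open>a i\<close> some period is in progress because \<open>i\<close> is
    waiting; afterwards it is the period of \<open>i\<close>. None of these belongs to
    \<open>j\<close>, whose period starts no earlier than \<open>C i\<close>.\<close>
  have "r j t = 0" if t: "s i < t" "t < C i" for t
  proof -
    have "\<exists>k<n. t \<in> X k"
    proof (cases "t < a i")
      case True
      then show ?thesis using waiting[OF ij(1), of t] t by auto
    next
      case False
      then show ?thesis using exclusive_until_completion[OF ij(1) good(1), of t] t ij by auto
    qed
    then obtain k where k: "k < n" "t \<in> X k" by auto
    moreover have "k \<noteq> j" using k t start by (auto simp: exclusive_period_def)
    ultimately show ?thesis using exclusive[OF k(1) ij(2) k(2)] by simp
  qed
  then have "E j (C i) = E j (s i)"
    using elapsed_const_rate[OF ij(2) s, of 0] by simp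
  also have "\<dots> \<le> E i (s i)"
    using s start ij by (intro elapsed_le_before_start) auto
  finally show "E j (C i) \<le> \<beta> i * p i" by (simp add: elapsed_signal ij)
  have "E i (s i) \<le> E j (s i)"
    using s le ij signal_le_start by (intro elapsed_le_before_start) auto
  also have "\<dots> \<le> E j (a j)" using s start ij by (intro elapsed_mono) auto
  finally show "\<beta> i * p i \<le> \<beta> j * p j" by (simp add: elapsed_signal elapsed_start ij)
qed

section \<open>Prediction error and summation over pairs\<close>

definition err :: "nat \<Rightarrow> real" where "err j = \<bar>\<beta> j - \<alpha>\<bar> * p j"

lemma err_nonneg: "j < n \<Longrightarrow> 0 \<le> err j"
  using p_pos[of j] by (simp add: err_def)

lemma err_bounds:
  assumes "j < n"
  shows "\<beta> j * p j \<le> \<alpha> * p j + err j" "\<alpha> * p j \<le> \<beta> j * p j + err j"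
  using p_pos[OF assms] by (auto simp: err_def abs_if algebra_simps)

text \<open>If \<open>i\<close> is the shorter job, only \<open>E j (C i)\<close> deviates, by at
  most \<open>\<eta>\<close>. If \<open>j\<close> is shorter, the order of the signal levels also
  shows that \<open>i\<close> is not much longer than \<open>j\<close>.\<close>

lemma delay_le_good_aux:
  assumes ij: "i < n" "j < n" "i \<noteq> j" and le: "C i \<le> C j"
    and good: "\<alpha> * \<rho> \<le> \<beta> i" "\<alpha> * \<rho> \<le> \<beta> j"
  shows "delay i j \<le> (1 + \<alpha>) * min (p i) (p j) + 2 / \<alpha> * (err i + err j)"
proof -
  note e = elapsed_other_le_signal[OF assms] signal_levels_ordered[OF assms]
  define \<eta> where "\<eta> = err i + err j"
  have err: "0 \<le> err i" "0 \<le> err j" using err_nonneg ij by auto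
  \<comment> \<open>Comparing \<open>p i\<close> with \<open>p j\<close> divides the error by
    \<open>\<alpha>\<close>. The two summands of the delay cost at most \<open>\<kappa>\<close>
    each, whence the factor \<open>2 / \<alpha>\<close>.\<close>
  define \<kappa> where "\<kappa> = \<eta> / \<alpha>"
  have \<eta>: "0 \<le> \<eta>" "\<eta> \<le> \<kappa>"
    using err \<alpha> mult_left_mono[of \<alpha> 1 \<eta>] by (auto simp: \<eta>_def \<kappa>_def field_simps)
  have "delay i j \<le> (1 + \<alpha>) * min (p i) (p j) + (\<kappa> + \<kappa>)"
  proof (cases "p i \<le> p j")
    case True
    have "E j (C i) \<le> \<alpha> * p i + \<eta>"
      using e err_bounds(1)[OF ij(1)] err by (simp add: \<eta>_def)
    then show ?thesis
      using True delay_eq[OF ij(1,2) le] \<eta> by (simp add: algebra_simps)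
  next
    case False
    have "\<alpha> * p i \<le> \<alpha> * p j + \<eta>"
      using e err_bounds(2)[OF ij(1)] err_bounds(1)[OF ij(2)] by (simp add: \<eta>_def)
    then have "p i \<le> p j + \<kappa>" using \<alpha> by (simp add: \<kappa>_def field_simps)
    moreover have "E j (C i) \<le> \<alpha> * p j + \<eta>"
      using e err_bounds(1)[OF ij(2)] err by (simp add: \<eta>_def)
    ultimately show ?thesis
      using False delay_eq[OF ij(1,2) le] \<eta> by (simp add: algebra_simps)
  qed
  then show ?thesis by (simp add: \<eta>_def \<kappa>_def)
qed

lemma delay_le_good:
  assumes "i < n" "j < n" "i \<noteq> j" "\<alpha> * \<rho> \<le> \<beta> i" "\<alpha> * \<rho> \<le> \<beta> j"
  shows "delay i j \<le> (1 + \<alpha>) * min (p i) (p j) + 2 / \<alpha> * (err i + err j)"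
proof (cases "C i \<le> C j")
  case True
  with assms show ?thesis by (intro delay_le_good_aux)
next
  case False
  then show ?thesis
    using delay_le_good_aux[of j i] assms
    by (simp add: delay_commute[of i j] min.commute[of "p i"] add.commute[of "err i"])
qed

lemma delay_self: "j < n \<Longrightarrow> delay j j = 2 * p j"
  by (simp add: delay_def elapsed_completion)

lemma delay_le_weight_if_le_min:
  assumes ij: "i < n" "j < n" and "0 \<le> c" "0 \<le> d"
    and le: "i \<noteq> j \<Longrightarrow> delay i j \<le> (1 + c) * min (p i) (p j) + d"
  shows "delay i j \<le> (1 + c) * pair_weight p i j + d"
proof (cases "i = j")
  case True
  then have "0 \<le> c * (2 * p j)" using assms p_pos[of j] by simp
  then show ?thesis using True ij assms(4) by (simp add: pair_weight_def delay_self algebra_simps)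
next
  case False
  then show ?thesis using le by (simp add: pair_weight_def)
qed

text \<open>Common frame of the three guarantees. Over ordered pairs, \<open>err i + err j\<close>
  sums to \<open>2 * n\<close> times the total error, and the factor 2 cancels against the double
  counting of delays.\<close>

lemma total_le_if_delay_le:
  assumes c: "0 \<le> c" and K: "0 \<le> K"
    and le: "\<And>i j. i < n \<Longrightarrow> j < n \<Longrightarrow> i \<noteq> j \<Longrightarrow>
      delay i j \<le> (1 + c) * min (p i) (p j) + K * (err i + err j)"
  shows "total_completion_time n p r \<le> (1 + c) * opt n p + K * real n * (\<Sum>j<n. err j)"
proof -
  have "2 * total_completion_time n p r
    \<le> (\<Sum>j<n. \<Sum>i<n. (1 + c) * pair_weight p i j + K * (err i + err j))"
    unfolding total_completion_time_eq using c K le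
    by (intro sum_mono delay_le_weight_if_le_min mult_nonneg_nonneg add_nonneg_nonneg err_nonneg) auto
  also have "\<dots> = (1 + c) * (\<Sum>j<n. \<Sum>i<n. pair_weight p i j) + 2 * (K * real n * (\<Sum>j<n. err j))"
    by (simp add: sum.distrib sum_distrib_left[symmetric] algebra_simps)
  also have "\<dots> \<le> (1 + c) * (2 * opt n p) + 2 * (K * real n * (\<Sum>j<n. err j))"
    using c opt_ge by (intro add_right_mono mult_left_mono) auto
  finally show ?thesis by simp
qed

section \<open>Consistency, robustness and smoothness\<close>

lemma consistency:
  assumes "\<forall>j<n. \<beta> j = \<alpha>"
  shows "total_completion_time n p r \<le> (1 + \<alpha>) * opt n p"
proof -
  have "\<alpha> * \<rho> \<le> \<beta> j" if "j < n" for j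
    using that assms \<alpha> \<rho> by (simp add: mult_left_le)
  then have "total_completion_time n p r \<le> (1 + \<alpha>) * opt n p + 2 / \<alpha> * real n * (\<Sum>j<n. err j)"
    using \<alpha> by (intro total_le_if_delay_le delay_le_good) auto
  also have "(\<Sum>j<n. err j) = 0" using assms by (simp add: err_def)
  finally show ?thesis by simp
qed

lemma robustness: "total_completion_time n p r \<le> (1 + 1 / (\<rho> * \<alpha>)) * opt n p"
proof -
  have "total_completion_time n p r
    \<le> (1 + 1 / (\<rho> * \<alpha>)) * opt n p + 0 * real n * (\<Sum>j<n. err j)"
  proof (rule total_le_if_delay_le)
    fix i j assume "i < n" "j < n"
    moreover have "(1 + 1 / (\<rho> * \<alpha>)) * m = m + m / (\<alpha> * \<rho>)" for m
      by (simp add: distrib_right mult.commute[of \<rho> \<alpha>])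
    ultimately show "delay i j \<le> (1 + 1 / (\<rho> * \<alpha>)) * min (p i) (p j) + 0 * (err i + err j)"
      using delay_le_robust[of i j] by simp
  qed (use \<alpha> \<rho> in auto)
  then show ?thesis by simp
qed

text \<open>The early signal makes \<open>err j\<close> at least
  \<open>\<alpha> * (1 - \<rho>) * p j\<close>. Dividing by
  \<open>\<rho> * (1 - \<rho>) * \<alpha>\<^sup>2\<close> leaves
  \<open>p j / (\<alpha> * \<rho>)\<close>, which covers the second term of the robust
  bound.\<close>

lemma delay_le_bad_aux:
  assumes ij: "i < n" "j < n" and "\<rho> < 1" and bad: "\<beta> j < \<alpha> * \<rho>"
  shows "delay i j \<le> min (p i) (p j) + err j / (\<rho> * (1 - \<rho>) * \<alpha>\<^sup>2)"
proof -
  have "\<alpha> * (1 - \<rho>) \<le> \<bar>\<beta> j - \<alpha>\<bar>" using bad by (simp add: algebra_simps)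
  then have "\<alpha> * (1 - \<rho>) * p j \<le> err j"
    unfolding err_def using p_pos[OF ij(2)] by (intro mult_right_mono) auto
  then have "\<alpha> * (1 - \<rho>) * p j / (\<rho> * (1 - \<rho>) * \<alpha>\<^sup>2) \<le> err j / (\<rho> * (1 - \<rho>) * \<alpha>\<^sup>2)"
    using \<rho> \<open>\<rho> < 1\<close> by (intro divide_right_mono) auto
  also have "\<alpha> * (1 - \<rho>) * p j / (\<rho> * (1 - \<rho>) * \<alpha>\<^sup>2) = p j / (\<alpha> * \<rho>)"
    using \<alpha> \<open>\<rho> < 1\<close> by (simp add: power2_eq_square)
  finally have "p j / (\<alpha> * \<rho>) \<le> err j / (\<rho> * (1 - \<rho>) * \<alpha>\<^sup>2)" .
  moreover have "min (p i) (p j) / (\<alpha> * \<rho>) \<le> p j / (\<alpha> * \<rho>)"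
    using \<alpha> \<rho> by (intro divide_right_mono) auto
  ultimately show ?thesis using delay_le_robust[OF ij] by simp
qed

lemma smoothness:
  assumes "\<rho> < 1"
  shows "total_completion_time n p r \<le> (1 + \<alpha>) * opt n p
    + 2 * real n / (\<rho> * (1 - \<rho>) * \<alpha>\<^sup>2) * (\<Sum>j<n. err j)"
proof -
  define D where "D = \<rho> * (1 - \<rho>) * \<alpha>\<^sup>2"
  have D: "0 < D" using \<alpha> \<rho> assms by (simp add: D_def)
  have "\<rho> * (1 - \<rho>) * \<alpha> \<le> 1"
    using \<alpha> \<rho> assms by (intro mult_le_one) auto
  \<comment> \<open>Thus the constant \<open>2 / D\<close> dominates the constant
    \<open>2 / \<alpha>\<close> of pairs without an early signal.\<close>
  then have "D \<le> \<alpha>" using \<alpha> by (simp add: D_def power2_eq_square)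
  then have K: "2 / \<alpha> \<le> 2 / D" using D by (intro divide_left_mono) auto
  have "total_completion_time n p r \<le> (1 + \<alpha>) * opt n p + 2 / D * real n * (\<Sum>j<n. err j)"
  proof (rule total_le_if_delay_le)
    fix i j assume ij: "i < n" "j < n" "i \<noteq> j"
    have err: "0 \<le> err i" "0 \<le> err j" using err_nonneg ij by auto
    have m: "0 \<le> \<alpha> * min (p i) (p j)" using \<alpha> p_pos[of i] p_pos[of j] ij by auto
    \<comment> \<open>Here \<open>e\<close> stands for the error of whichever job of the pair
      signals early; both cases then follow by symmetry of \<open>delay\<close>.\<close>
    have bad: "delay i j \<le> (1 + \<alpha>) * min (p i) (p j) + 2 / D * (err i + err j)"
      if "delay i j \<le> min (p i) (p j) + e / D" "e \<le> err i + err j" for e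
    proof -
      have "e / D \<le> (err i + err j) / D" using that D by (intro divide_right_mono) auto
      moreover have "0 \<le> (err i + err j) / D" using err D by simp
      ultimately show ?thesis using that m by (simp add: algebra_simps add_divide_distrib)
    qed
    consider "\<beta> i < \<alpha> * \<rho>" | "\<beta> j < \<alpha> * \<rho>" | "\<alpha> * \<rho> \<le> \<beta> i" "\<alpha> * \<rho> \<le> \<beta> j" by linarith
    then show "delay i j \<le> (1 + \<alpha>) * min (p i) (p j) + 2 / D * (err i + err j)"
    proof cases
      case 1
      then show ?thesis using delay_le_bad_aux[OF ij(2,1) assms] err
        by (intro bad[of "err i"]) (auto simp: D_def delay_commute[of i j] min.commute)
    next
      case 2
      then show ?thesis using delay_le_bad_aux[OF ij(1,2) assms] err
        by (intro bad[of "err j"]) (auto simp: D_def)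
    next
      case 3
      have "2 / \<alpha> * (err i + err j) \<le> 2 / D * (err i + err j)"
        using K err by (intro mult_right_mono) auto
      then show ?thesis using delay_le_good[OF ij 3] by linarith
    qed
  qed (use \<alpha> D in auto)
  then show ?thesis by (simp add: D_def)
qed

end

theorem theorem2:
  fixes \<alpha> \<rho> :: real and n :: nat and p \<beta> :: "nat \<Rightarrow> real" and r :: "nat \<Rightarrow> real \<Rightarrow> real"
  assumes "0 < \<alpha>" and "\<alpha> \<le> 1" and "0 < \<rho>" and "\<rho> \<le> 1"
    and "\<And>j. j < n \<Longrightarrow> 0 < p j"
    and "\<And>j. j < n \<Longrightarrow> 0 \<le> \<beta> j \<and> \<beta> j \<le> 1"
    and "algorithm_run \<alpha> \<rho> n p \<beta> r"
  shows "((\<forall>j<n. \<beta> j = \<alpha>) \<longrightarrow> total_completion_time n p r \<le> (1 + \<alpha>) * opt n p) \<and>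
    total_completion_time n p r \<le> (1 + 1 / (\<rho> * \<alpha>)) * opt n p \<and>
    (\<rho> < 1 \<longrightarrow>
       total_completion_time n p r \<le> (1 + \<alpha>) * opt n p
         + 2 * real n / (\<rho> * (1 - \<rho>) * \<alpha>\<^sup>2) * (\<Sum>i<n. \<bar>\<beta> i - \<alpha>\<bar> * p i))"
proof -
  obtain a where "schedule n p r"
    and a: "\<forall>j<n. signal_time p \<beta> r j \<le> a j"
      "\<forall>j<n. \<forall>t. signal_time p \<beta> r j \<le> t \<and> t < a j \<longrightarrow>
        (\<exists>i<n. t \<in> exclusive_period \<alpha> \<rho> p \<beta> r i (a i))"
      "\<forall>i<n. \<forall>t \<in> exclusive_period \<alpha> \<rho> p \<beta> r i (a i).
        \<forall>j<n. r j t = (if j = i then 1 else 0)"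
      "\<forall>t\<ge>0. (\<forall>i<n. t \<notin> exclusive_period \<alpha> \<rho> p \<beta> r i (a i)) \<longrightarrow>
        (\<forall>j<n. r j t = setf_rate n p r j t)"
    using assms(7) unfolding algorithm_run_def by (elim conjE exE) (rule that)
  interpret signal_run n p r \<alpha> \<rho> \<beta> a
  proof unfold_locales
    fix j t assume "j < n"
    then show "0 < p j" "0 \<le> \<beta> j" "\<beta> j \<le> 1" "signal_time p \<beta> r j \<le> a j"
      using assms(5,6) a(1) by simp_all
    show "\<exists>i<n. t \<in> exclusive_period \<alpha> \<rho> p \<beta> r i (a i)"
      if "signal_time p \<beta> r j \<le> t" "t < a j"
      using a(2) \<open>j < n\<close> that by blast
    show "r j t = setf_rate n p r j t"
      if "0 \<le> t" "\<And>i. i < n \<Longrightarrow> t \<notin> exclusive_period \<alpha> \<rho> p \<beta> r i (a i)"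
      using a(4) \<open>j < n\<close> that by blast
    show "r j t = (if j = i then 1 else 0)"
      if "i < n" "t \<in> exclusive_period \<alpha> \<rho> p \<beta> r i (a i)" for i
      using a(3) \<open>j < n\<close> that by blast
  qed fact+
  show ?thesis using consistency robustness smoothness by (simp add: err_def)
qed

end
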